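(* Let $X$ be an ordered Banach space with normal cone and assume that every order bounded increasing sequence in $X$ has a supremum. If $X$ is separable (with respect to the norm topology), then every order bounded increasing sequence in $X$ is norm convergent.
   Context: An ordered Banach space is a real Banach space $X$ together with a norm closed cone $X_+$, i.e. a norm closed non-empty subset $X_+ \subseteq X$ with $\alpha X_+ + \beta X_+ \subseteq X_+$ for all scalars $\alpha,\beta \in [0,\infty)$ and $X_+ \cap (-X_+) = \{0\}$. The partial order is given by $x \le y$ iff $y - x \in X_+$. The cone $X_+$ is normal if there is a constant $C \ge 0$ such that $\|x\| \le C\|y\|$ for all $x,y \in X$ with $0 \le x \le y$. A sequence $(x_n)$ is increasing if $x_n \le x_m$ whenever $n \le m$. A set (or sequence) is order bounded if it is contained in an order interval $[x,z] = \{y \in X : x \le y \le z\}$. The supremum of a set $S \subseteq X$ is an upper bound $z$ of $S$ such that every upper bound $\tilde z$ of $S$ satisfies $\tilde z \ge z$. *)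

theory Defs
  imports "HOL-Analysis.Analysis"
begin

text \<open>
  The underlying real Banach space is the type \<open>'a::banach\<close>; the cone \<open>K\<close> is an explicit set rather
  than the positive cone of a type class order, so that no order on \<open>'a\<close> is presupposed.
\<close>

locale ordered_banach_space =
  fixes K :: "'a::banach set"
  assumes cone_closed: "closed K"
    and cone_nonempty: "K \<noteq> {}"
    and cone_combination:
      "\<And>\<alpha> \<beta> x y. \<lbrakk>0 \<le> \<alpha>; 0 \<le> \<beta>; x \<in> K; y \<in> K\<rbrakk> \<Longrightarrow> \<alpha> *\<^sub>R x + \<beta> *\<^sub>R y \<in> K"
    and cone_pointed: "K \<inter> uminus ` K = {0}"

definition cone_le :: "'a::real_normed_vector set \<Rightarrow> 'a \<Rightarrow> 'a \<Rightarrow> bool"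
  where "cone_le K x y \<longleftrightarrow> y - x \<in> K"

definition normal_cone :: "'a::real_normed_vector set \<Rightarrow> bool"
  where "normal_cone K \<longleftrightarrow>
    (\<exists>C\<ge>0. \<forall>x y. cone_le K 0 x \<and> cone_le K x y \<longrightarrow> norm x \<le> C * norm y)"

definition cone_incseq :: "'a::real_normed_vector set \<Rightarrow> (nat \<Rightarrow> 'a) \<Rightarrow> bool"
  where "cone_incseq K x \<longleftrightarrow> monotone (\<le>) (cone_le K) x"

definition order_interval :: "'a::real_normed_vector set \<Rightarrow> 'a \<Rightarrow> 'a \<Rightarrow> 'a set"
  where "order_interval K x z = {y. cone_le K x y \<and> cone_le K y z}"

definition order_bounded :: "'a::real_normed_vector set \<Rightarrow> 'a set \<Rightarrow> bool"
  where "order_bounded K S \<longleftrightarrow> (\<exists>x z. S \<subseteq> order_interval K x z)"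

definition cone_upper_bound :: "'a::real_normed_vector set \<Rightarrow> 'a set \<Rightarrow> 'a \<Rightarrow> bool"
  where "cone_upper_bound K S z \<longleftrightarrow> (\<forall>s\<in>S. cone_le K s z)"

definition cone_supremum :: "'a::real_normed_vector set \<Rightarrow> 'a set \<Rightarrow> 'a \<Rightarrow> bool"
  where "cone_supremum K S z \<longleftrightarrow>
    cone_upper_bound K S z \<and> (\<forall>w. cone_upper_bound K S w \<longrightarrow> cone_le K z w)"

end

theory Submission
  imports Defs
begin

text \<open>
  The argument adapts Rosenthal's disjointification lemma to the order setting, so that no
  functionals are needed.

  If an order bounded increasing sequence is not Cauchy, differences along a subsequence give
  vectors \<open>d n\<close> in the cone whose norms are bounded away from zero and whose finite sums are all
  dominated by one vector. For a set \<open>A\<close> of indices let \<open>s A\<close> be the supremum of the partial sums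
  of \<open>d\<close> over \<open>A\<close>. Then \<open>s\<close> is monotone and superadditive on disjoint sets.

  The main step (\<open>disjointification\<close>) finds an infinite set \<open>M\<close> and some \<open>\<delta> > 0\<close> such that, for
  \<open>n \<in> M\<close>, the vector \<open>d n\<close> is not dominated by \<open>s (M - {n})\<close> up to an error of norm below \<open>\<delta>\<close>.
  If there were no such \<open>M\<close>, repeatedly splitting an infinite index set into infinitely many
  infinite pieces and selecting one bad index from each would, after \<open>k\<close> rounds, yield an \<open>n\<close> for
  which \<open>d n\<close> is approximately dominated by \<open>s\<close> of \<open>k\<close> pairwise disjoint sets. Averaging gives
  \<open>d n \<le> (1/k) (s UNIV - s {}) + y\<close> with \<open>norm y \<le> \<delta>\<close>, and normality of the cone then makes \<open>norm (d n)\<close>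
  too small.

  For distinct \<open>A, B \<subseteq> M\<close>, the vectors \<open>s A\<close> and \<open>s B\<close> have distance at least \<open>\<delta>\<close>, because an index
  \<open>n \<in> A - B\<close> satisfies \<open>d n \<le> s A = s B + (s A - s B) \<le> s (M - {n}) + (s A - s B)\<close>. A separable
  space has no such family indexed by the uncountable set \<open>Pow M\<close>.
\<close>

section \<open>Set-theoretic and metric preliminaries\<close>

lemma infinite_partition:
  fixes M :: "nat set"
  assumes "infinite M"
  obtains N :: "nat \<Rightarrow> nat set"
  where "\<And>p. infinite (N p)" "\<And>p. N p \<subseteq> M" "\<And>p q. p \<noteq> q \<Longrightarrow> N p \<inter> N q = {}"
proof
  define f where "f p q = enumerate M (prod_encode (p, q))" for p q
  have inj: "f p q = f p' q' \<longleftrightarrow> p = p' \<and> q = q'" for p q p' q'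
    using strict_mono_enumerate[OF assms] by (auto simp: f_def strict_mono_eq)
  show "infinite (range (f p))" for p
    by (rule range_inj_infinite) (simp add: inj_def inj)
  show "range (f p) \<subseteq> M" for p
    using enumerate_in_set[OF assms] by (auto simp: f_def)
  show "range (f p) \<inter> range (f q) = {}" if "p \<noteq> q" for p q
    using that by (auto simp: inj)
qed

lemma uncountable_Pow_of_infinite:
  assumes "infinite M"
  shows "uncountable (Pow M)"
proof
  assume "countable (Pow M)"
  define g where "g = from_nat_into (Pow M)"
  have g: "range g = Pow M"
    unfolding g_def using \<open>countable (Pow M)\<close> by (intro range_from_nat_into) auto
  obtain f :: "nat \<Rightarrow> _" where f: "inj f" "range f \<subseteq> M"
    using assms infinite_countable_subset by blast
  define X where "X = f ` {n. f n \<notin> g n}"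
  have "X \<in> range g"
    unfolding g using f(2) by (auto simp: X_def)
  then obtain m where m: "X = g m"
    by blast
  have "f m \<in> X \<longleftrightarrow> f m \<notin> g m"
    using f(1) by (simp add: X_def inj_image_mem_iff)
  with m show False
    by blast
qed

lemma separable_separated_family_countable:
  fixes s :: "'i \<Rightarrow> 'a::metric_space"
  assumes "separable_space (euclidean :: 'a topology)" and "\<delta> > 0"
    and sep: "\<And>i j. \<lbrakk>i \<in> I; j \<in> I; i \<noteq> j\<rbrakk> \<Longrightarrow> dist (s i) (s j) \<ge> \<delta>"
  shows "countable I"
proof -
  obtain D :: "'a set" where D: "countable D" "closure D = UNIV"
    using assms(1) by (auto simp: separable_space_def)
  have "\<exists>q\<in>D. dist q (s i) < \<delta> / 2" for i
    using D(2) \<open>\<delta> > 0\<close> closure_approachable[of "s i" D] by (metis UNIV_I half_gt_zero)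
  then obtain q where q: "\<And>i. q i \<in> D" "\<And>i. dist (q i) (s i) < \<delta> / 2"
    by metis
  have "inj_on q I"
  proof (rule inj_onI, rule ccontr)
    fix i j assume ij: "i \<in> I" "j \<in> I" "q i = q j" "i \<noteq> j"
    have "dist (s i) (s j) < \<delta>"
      using q(2)[of i] q(2)[of j] ij(3) by (metis dist_triangle_half_r)
    then show False
      using sep ij by fastforce
  qed
  moreover have "countable (q ` I)"
    using D(1) q(1) by (meson countable_subset image_subsetI)
  ultimately show ?thesis
    using countable_image_inj_on by blast
qed

text \<open>
  Failure of the Cauchy property, in a form where the gaps occur between consecutive terms of
  a single subsequence.
\<close>

lemma not_Cauchy_subsequence:
  fixes x :: "nat \<Rightarrow> 'a::metric_space"
  assumes "\<not> Cauchy x"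
  obtains \<epsilon> k where "\<epsilon> > 0" "strict_mono k" "\<And>n. dist (x (k n)) (x (k (Suc n))) \<ge> \<epsilon>"
proof -
  obtain e where e: "e > 0" "\<And>N. \<exists>m\<ge>N. \<exists>n\<ge>N. dist (x m) (x n) \<ge> e"
    using assms unfolding Cauchy_def by (meson not_less)
  have "\<exists>m>N. dist (x N) (x m) \<ge> e / 2" for N
  proof -
    obtain m n where mn: "m \<ge> N" "n \<ge> N" "dist (x m) (x n) \<ge> e"
      using e(2) by blast
    have "dist (x N) (x m) \<ge> e / 2 \<or> dist (x N) (x n) \<ge> e / 2"
      using mn(3) dist_triangle2[of "x m" "x n" "x N"] by (auto simp: dist_commute)
    moreover have "N < l" if "N \<le> l" "dist (x N) (x l) \<ge> e / 2" for l
      using that e(1) by (cases "l = N") auto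
    ultimately show ?thesis
      using mn by blast
  qed
  then obtain h where h: "\<And>N. h N > N" "\<And>N. dist (x N) (x (h N)) \<ge> e / 2"
    by metis
  show thesis
  proof
    show "e / 2 > 0" using e by simp
    show "strict_mono (\<lambda>n. (h ^^ n) 0)"
      by (simp add: strict_mono_Suc_iff h)
    show "dist (x ((h ^^ n) 0)) (x ((h ^^ Suc n) 0)) \<ge> e / 2" for n
      using h(2)[of "(h ^^ n) 0"] by simp
  qed
qed

section \<open>The order induced by a cone\<close>

context ordered_banach_space
begin

abbreviation le :: "'a \<Rightarrow> 'a \<Rightarrow> bool" (infix \<open>\<preceq>\<close> 50)
  where "x \<preceq> y \<equiv> cone_le K x y"

lemma zero_in_cone: "0 \<in> K"
  using cone_pointed by blast

lemma cone_add: "x \<in> K \<Longrightarrow> y \<in> K \<Longrightarrow> x + y \<in> K"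
  using cone_combination[of 1 1 x y] by simp

lemma cone_scaleR: "0 \<le> a \<Longrightarrow> x \<in> K \<Longrightarrow> a *\<^sub>R x \<in> K"
  using cone_combination[of a 0 x x] by simp

lemma le_refl: "x \<preceq> x"
  by (simp add: cone_le_def zero_in_cone)

lemma le_trans [trans]: "x \<preceq> y \<Longrightarrow> y \<preceq> z \<Longrightarrow> x \<preceq> z"
  unfolding cone_le_def using cone_add[of "z - y" "y - x"] by simp

lemma le_add_mono: "x \<preceq> y \<Longrightarrow> u \<preceq> v \<Longrightarrow> x + u \<preceq> y + v"
  unfolding cone_le_def using cone_add[of "y - x" "v - u"] by (simp add: algebra_simps)

lemma le_scaleR_mono: "0 \<le> a \<Longrightarrow> x \<preceq> y \<Longrightarrow> a *\<^sub>R x \<preceq> a *\<^sub>R y"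
  unfolding cone_le_def using cone_scaleR[of a "y - x"] by (simp add: algebra_simps)

lemma zero_le_iff: "0 \<preceq> x \<longleftrightarrow> x \<in> K"
  by (simp add: cone_le_def)

lemma sum_in_cone:
  assumes "\<And>i. i \<in> I \<Longrightarrow> f i \<in> K"
  shows "sum f I \<in> K"
  using assms by (induction I rule: infinite_finite_induct) (auto simp: zero_in_cone cone_add)

lemma sum_mono_subset:
  assumes "finite B" "A \<subseteq> B" "\<And>i. i \<in> B \<Longrightarrow> 0 \<preceq> f i"
  shows "sum f A \<preceq> sum f B"
  unfolding cone_le_def using assms
  by (auto simp: sum_diff[symmetric] zero_le_iff intro!: sum_in_cone)

section \<open>Order-theoretic disjointification\<close>

text \<open>
  A counterpart of Rosenthal's disjointification lemma for a single monotone, disjointly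
  superadditive set function \<open>s\<close> with values in the ordered space, where "\<open>d n\<close> is dominated by
  \<open>s (M - {n})\<close> up to a small error" replaces "the \<open>n\<close>-th measure gives \<open>M - {n}\<close> large mass".
\<close>

lemma disjointification:
  fixes d :: "nat \<Rightarrow> 'a" and s :: "nat set \<Rightarrow> 'a"
  assumes normal: "normal_cone K"
    and s_mono: "\<And>A B. A \<subseteq> B \<Longrightarrow> s A \<preceq> s B"
    and s_superadd: "\<And>A B. A \<inter> B = {} \<Longrightarrow> s A + s B \<preceq> s (A \<union> B)"
    and d_nonneg: "\<And>n. 0 \<preceq> d n"
    and "\<epsilon> > 0" and d_norm: "\<And>n. norm (d n) \<ge> \<epsilon>"
  obtains M \<delta> where "infinite M" "\<delta> > 0"
    "\<And>n y. \<lbrakk>n \<in> M; norm y < \<delta>\<rbrakk> \<Longrightarrow> \<not> d n \<preceq> s (M - {n}) + y"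
proof -
  obtain C where "C \<ge> 0" and C: "\<And>x y. 0 \<preceq> x \<Longrightarrow> x \<preceq> y \<Longrightarrow> norm x \<le> C * norm y"
    using normal unfolding normal_cone_def by blast
  define \<delta> where "\<delta> = \<epsilon> / (2 * (C + 1))"
  have "\<delta> > 0"
    using \<open>\<epsilon> > 0\<close> \<open>C \<ge> 0\<close> by (simp add: \<delta>_def)
  have "\<exists>M. infinite M \<and> (\<forall>n\<in>M. \<forall>y. norm y < \<delta> \<longrightarrow> \<not> d n \<preceq> s (M - {n}) + y)"
  proof (rule ccontr)
    assume "\<not> ?thesis"
    then have bad: "\<exists>n\<in>M. \<exists>y. norm y < \<delta> \<and> d n \<preceq> s (M - {n}) + y" if "infinite M" for M
      using that by blast
    \<comment> \<open>\<open>M\<close> is the set of indices surviving \<open>k\<close> rounds; its complement contains the disjoint sets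
      whose values under \<open>s\<close> have been collected so far. The offset \<open>s {}\<close> makes the case of no
      rounds hold without assuming \<open>s\<close> to be nonnegative.\<close>
    have rounds: "\<exists>M. infinite M \<and>
        (\<forall>n\<in>M. \<exists>y. norm y \<le> real k * \<delta> \<and> real k *\<^sub>R d n + s {} \<preceq> s (- M) + y)" for k
    proof (induction k)
      case 0
      have "s {} \<preceq> s (- UNIV) + 0"
        by (simp add: le_refl)
      then show ?case
        by (intro exI[of _ UNIV]) (auto intro!: exI[of _ 0] le_refl)
    next
      case (Suc k)
      then obtain M where M: "infinite M" and
        IH: "\<And>n. n \<in> M \<Longrightarrow> \<exists>y. norm y \<le> real k * \<delta> \<and> real k *\<^sub>R d n + s {} \<preceq> s (- M) + y"
        by blast
      obtain N :: "nat \<Rightarrow> nat set" where N: "\<And>p. infinite (N p)" "\<And>p. N p \<subseteq> M"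
        "\<And>p q. p \<noteq> q \<Longrightarrow> N p \<inter> N q = {}"
        using infinite_partition[OF M] by blast
      obtain i where i: "\<And>p. i p \<in> N p"
        "\<And>p. \<exists>y. norm y < \<delta> \<and> d (i p) \<preceq> s (N p - {i p}) + y"
        using bad[OF N(1)] by metis
      have i_in: "i p \<in> N q \<longleftrightarrow> p = q" for p q
        using i(1)[of p] N(3)[of p q] by blast
      \<comment> \<open>One bad index from each piece: \<open>range i\<close> is disjoint from every \<open>N p - {i p}\<close>.\<close>
      have "inj i"
        by (metis i_in injI)
      have "\<exists>y. norm y \<le> real (Suc k) * \<delta> \<and>
          real (Suc k) *\<^sub>R d (i p) + s {} \<preceq> s (- range i) + y" for p
      proof -
        obtain y where y: "norm y \<le> real k * \<delta>" "real k *\<^sub>R d (i p) + s {} \<preceq> s (- M) + y"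
          using IH[of "i p"] i(1) N(2) by blast
        obtain y' where y': "norm y' < \<delta>" "d (i p) \<preceq> s (N p - {i p}) + y'"
          using i(2) by blast
        have "(real k *\<^sub>R d (i p) + s {}) + d (i p) \<preceq> (s (- M) + y) + (s (N p - {i p}) + y')"
          by (rule le_add_mono[OF y(2) y'(2)])
        also have "(s (- M) + y) + (s (N p - {i p}) + y') =
            (s (- M) + s (N p - {i p})) + (y + y')"
          by simp
        also have "(s (- M) + s (N p - {i p})) + (y + y') \<preceq>
            s (- M \<union> (N p - {i p})) + (y + y')"
          using N(2) by (intro le_add_mono s_superadd le_refl) blast
        also have "s (- M \<union> (N p - {i p})) + (y + y') \<preceq> s (- range i) + (y + y')"
        proof (intro le_add_mono s_mono le_refl)
          have "i q \<in> M" for q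
            using i(1) N(2) by blast
          then show "- M \<union> (N p - {i p}) \<subseteq> - range i"
            by (auto simp: i_in)
        qed
        finally have "real (Suc k) *\<^sub>R d (i p) + s {} \<preceq> s (- range i) + (y + y')"
          by (simp add: algebra_simps)
        moreover have "norm (y + y') \<le> real (Suc k) * \<delta>"
          using norm_triangle_ineq[of y y'] y(1) y'(1) by (simp add: algebra_simps)
        ultimately show ?thesis by blast
      qed
      then show ?case
        using range_inj_infinite[OF \<open>inj i\<close>] by blast
    qed
    define b where "b = s UNIV - s {}"
    obtain k :: nat where k: "real k > 2 * C * norm b / \<epsilon>"
      using reals_Archimedean2 by blast
    have "2 * C * norm b / \<epsilon> \<ge> 0"
      using \<open>C \<ge> 0\<close> \<open>\<epsilon> > 0\<close> by simp
    with k have k_pos: "real k > 0"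
      by linarith
    obtain n y where y: "norm y \<le> real k * \<delta>" and "real k *\<^sub>R d n + s {} \<preceq> s UNIV + y"
    proof -
      obtain M where "infinite M" and
        M: "\<forall>n\<in>M. \<exists>y. norm y \<le> real k * \<delta> \<and> real k *\<^sub>R d n + s {} \<preceq> s (- M) + y"
        using rounds by blast
      then obtain n where "n \<in> M"
        using infinite_imp_nonempty by blast
      with M obtain y where "norm y \<le> real k * \<delta>" "real k *\<^sub>R d n + s {} \<preceq> s (- M) + y"
        by blast
      moreover have "s (- M) + y \<preceq> s UNIV + y"
        by (intro le_add_mono s_mono le_refl) simp
      ultimately show thesis
        using that le_trans by blast
    qed
    then have "real k *\<^sub>R d n \<preceq> b + y"
      by (simp add: cone_le_def b_def algebra_simps)
    moreover have "0 \<preceq> real k *\<^sub>R d n"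
      using le_scaleR_mono[OF _ d_nonneg, of "real k" n] by simp
    ultimately have "norm (real k *\<^sub>R d n) \<le> C * norm (b + y)"
      by (rule C[rotated])
    also have "\<dots> \<le> C * (norm b + real k * \<delta>)"
      using \<open>C \<ge> 0\<close> y norm_triangle_ineq[of b y] by (intro mult_left_mono) auto
    also have "\<dots> = C * norm b + real k * (C * \<delta>)"
      by (simp add: algebra_simps)
    also have "\<dots> < real k * (\<epsilon> / 2) + real k * (\<epsilon> / 2)"
    proof (rule add_less_le_mono)
      show "C * norm b < real k * (\<epsilon> / 2)"
        using k \<open>\<epsilon> > 0\<close> by (simp add: field_simps)
      have "C * \<delta> \<le> \<epsilon> / 2"
        using \<open>\<epsilon> > 0\<close> \<open>C \<ge> 0\<close> by (simp add: \<delta>_def field_simps)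
      then show "real k * (C * \<delta>) \<le> real k * (\<epsilon> / 2)"
        by (intro mult_left_mono) auto
    qed
    finally have "real k * norm (d n) < real k * \<epsilon>"
      by (simp add: mult.commute)
    then show False
      using d_norm[of n] k_pos by simp
  qed
  with \<open>\<delta> > 0\<close> show thesis
    using that by blast
qed

section \<open>Suprema of partial sums over index sets\<close>

text \<open>
  This is the series form of the main result. The set function \<open>s\<close> exists by the assumption on
  suprema of increasing sequences, and separability excludes that it separates all subsets of an
  infinite set.
\<close>

lemma null_terms_of_bounded_sums:
  fixes d :: "nat \<Rightarrow> 'a"
  assumes normal: "normal_cone K"
    and sigma_complete: "\<And>x :: nat \<Rightarrow> 'a. cone_incseq K x \<Longrightarrow> order_bounded K (range x) \<Longrightarrow>
           \<exists>z. cone_supremum K (range x) z"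
    and separable: "separable_space (euclidean :: 'a topology)"
    and d_nonneg: "\<And>n. 0 \<preceq> d n"
    and bound: "\<And>N. sum d {..<N} \<preceq> b"
    and "\<epsilon> > 0"
  shows "\<exists>n. norm (d n) < \<epsilon>"
proof (rule ccontr)
  assume "\<not> ?thesis"
  then have d_norm: "norm (d n) \<ge> \<epsilon>" for n
    by (simp add: not_less)
  define S where "S A N = sum d (A \<inter> {..<N})" for A N
  have S_mono: "S A N \<preceq> S B N'" if "A \<subseteq> B" "N \<le> N'" for A B N N'
    unfolding S_def using that d_nonneg by (intro sum_mono_subset) auto
  have "\<exists>z. cone_supremum K (range (S A)) z" for A
  proof (rule sigma_complete)
    show "cone_incseq K (S A)"
      unfolding cone_incseq_def by (intro monotoneI S_mono) auto
    have "0 \<preceq> S A N" for N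
      using d_nonneg by (auto simp: S_def zero_le_iff intro: sum_in_cone)
    moreover have "S A N \<preceq> b" for N
      using le_trans[OF S_mono[of A UNIV N N], of b] bound[of N] by (simp add: S_def)
    ultimately show "order_bounded K (range (S A))"
      unfolding order_bounded_def order_interval_def by blast
  qed
  then obtain s where s: "\<And>A. cone_supremum K (range (S A)) (s A)"
    by metis
  have s_upper: "S A N \<preceq> s A" for A N
    using s[of A] by (auto simp: cone_supremum_def cone_upper_bound_def)
  have s_least: "s A \<preceq> w" if "\<And>N. S A N \<preceq> w" for A w
    using s[of A] that by (auto simp: cone_supremum_def cone_upper_bound_def)
  have s_mono: "s A \<preceq> s B" if "A \<subseteq> B" for A B
    using S_mono[OF that order_refl] s_upper le_trans by (intro s_least) blast
  have s_superadd: "s A + s B \<preceq> s (A \<union> B)" if disj: "A \<inter> B = {}" for A B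
  proof -
    have "S A N + S B N' \<preceq> s (A \<union> B)" for N N'
    proof -
      have "S A N + S B N' \<preceq> S A (max N N') + S B (max N N')"
        by (intro le_add_mono S_mono) auto
      also have "S A (max N N') + S B (max N N') = S (A \<union> B) (max N N')"
        using disj by (simp add: S_def Int_Un_distrib2) (subst sum.union_disjoint; auto)
      also have "S (A \<union> B) (max N N') \<preceq> s (A \<union> B)"
        by (rule s_upper)
      finally show ?thesis .
    qed
    \<comment> \<open>Take the two suprema one after the other, moving the remaining term to the right.\<close>
    then have "s A \<preceq> s (A \<union> B) - S B N'" for N'
      by (intro s_least) (simp add: cone_le_def algebra_simps)
    then have "s B \<preceq> s (A \<union> B) - s A"
      by (intro s_least) (simp add: cone_le_def algebra_simps)
    then show ?thesis
      by (simp add: cone_le_def algebra_simps)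
  qed
  have d_le_s: "d n \<preceq> s A" if "n \<in> A" for n A
  proof -
    have "sum d {n} \<preceq> S A (Suc n)"
      unfolding S_def using that d_nonneg by (intro sum_mono_subset) auto
    then show ?thesis
      using le_trans s_upper by auto
  qed
  obtain M \<delta> where M: "infinite M" "\<delta> > 0"
    and not_dominated: "\<And>n y. \<lbrakk>n \<in> M; norm y < \<delta>\<rbrakk> \<Longrightarrow> \<not> d n \<preceq> s (M - {n}) + y"
    using disjointification[of s d \<epsilon>, OF normal s_mono s_superadd d_nonneg \<open>\<epsilon> > 0\<close> d_norm]
    by blast
  have sep: "norm (s A - s B) \<ge> \<delta>" if "A \<subseteq> M" "B \<subseteq> M" "n \<in> A - B" for A B n
  proof (rule ccontr)
    assume "\<not> ?thesis"
    then have "\<not> d n \<preceq> s (M - {n}) + (s A - s B)"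
      using not_dominated that by auto
    moreover have "s B + (s A - s B) \<preceq> s (M - {n}) + (s A - s B)"
      using that by (intro le_add_mono s_mono le_refl) auto
    ultimately show False
      using d_le_s[of n A] that le_trans by auto
  qed
  have "countable (Pow M)"
  proof (rule separable_separated_family_countable[OF separable M(2)])
    fix A B assume "A \<in> Pow M" "B \<in> Pow M" "A \<noteq> B"
    then show "dist (s A) (s B) \<ge> \<delta>"
      using sep[of A B] sep[of B A] by (auto simp: dist_norm norm_minus_commute)
  qed
  then show False
    using uncountable_Pow_of_infinite[OF M(1)] by blast
qed

end

section \<open>Convergence of order bounded increasing sequences\<close>

theorem theorem3p1:
  fixes K :: "'a::banach set"
  assumes "ordered_banach_space K"
    and "normal_cone K"
    and "\<And>x :: nat \<Rightarrow> 'a. cone_incseq K x \<Longrightarrow> order_bounded K (range x) \<Longrightarrow>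
           \<exists>z. cone_supremum K (range x) z"
    and "separable_space (euclidean :: 'a topology)"
  shows "\<forall>x :: nat \<Rightarrow> 'a. cone_incseq K x \<longrightarrow> order_bounded K (range x) \<longrightarrow> convergent x"
proof (intro allI impI, rule ccontr)
  fix x :: "nat \<Rightarrow> 'a"
  assume inc: "cone_incseq K x" and bdd: "order_bounded K (range x)" and "\<not> convergent x"
  then have "\<not> Cauchy x"
    using Cauchy_convergent by blast
  then obtain \<epsilon> k where "\<epsilon> > 0" and k: "strict_mono k"
    and gap: "\<And>n. dist (x (k n)) (x (k (Suc n))) \<ge> \<epsilon>"
    using not_Cauchy_subsequence by blast
  obtain z where z: "\<And>n. cone_le K (x n) z"
    using bdd by (auto simp: order_bounded_def order_interval_def)
  define d where "d n = x (k (Suc n)) - x (k n)" for n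
  have "cone_le K (x (k n)) (x (k (Suc n)))" for n
    using inc strict_mono_mono[OF k] by (simp add: cone_incseq_def monotone_def)
  then have d_nonneg: "cone_le K 0 (d n)" for n
    by (simp add: cone_le_def d_def)
  have "sum d {..<N} = x (k N) - x (k 0)" for N
    unfolding d_def by (rule sum_lessThan_telescope)
  then have "cone_le K (sum d {..<N}) (z - x (k 0))" for N
    using z[of "k N"] by (simp add: cone_le_def)
  then have "\<exists>n. norm (d n) < \<epsilon>"
    using d_nonneg \<open>\<epsilon> > 0\<close> assms(3)
    by (intro ordered_banach_space.null_terms_of_bounded_sums[OF assms(1,2) _ assms(4)])
  then obtain n where "norm (d n) < \<epsilon>"
    by blast
  then show False
    using gap[of n] by (simp add: d_def dist_norm norm_minus_commute)
qed

end
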